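(* Let $F:\mathbb{R}^d\to\mathbb{R}^d$ be a vector field with set of unstable zeros $\mathcal{Z}^*$, let $G:\mathbb{R}^d\times\Xi\to\mathbb{R}^d$ be an oracle, let $\{\alpha_k\}_{k\ge 0}$ be step-sizes, let $\{\xi^k\}_{k\ge0}$ be a seed sequence and $z^0$ a random initial point, all as in the probability model of the context. Suppose that the structural assumption (regularity, local equicontinuity, lipeomorphism with threshold $\tilde\alpha$) and the stochastic oracle assumption stated in the context hold, and that $0<\alpha_k\le\tilde\alpha$ for all $k$, $\alpha_k\to0$ and $\sum_{k=0}^\infty\alpha_k=\infty$. Let $\{z^k\}_{k\ge 0}$ be generated by $$z^{k+1}=z^k-\alpha_kG(z^k;\xi^k),\qquad k\ge0 .$$ Then the recursion almost surely avoids unstable zeros, i.e. $$\mathbb{P}\Big(\lim_{k\to\infty}z^k\in\mathcal{Z}^*\Big)=0,$$ where the event is that $\{z^k\}_k$ converges and its limit lies in $\mathcal{Z}^*$.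
   Context: Unstable zeros. A point $z^*\in\mathbb{R}^d$ is an unstable zero of $F$ if $F(z^* )=0$ and the derivative $\mathrm{D}F(z^* )$ has an eigenvalue with negative real part. $\mathcal{Z}^*$ is the set of all unstable zeros of $F$. Probability model. $(\Xi,\mathcal{A})$ is a measurable space. $(\Omega_0,\mathcal{F}_0,\mathbb{P}_0)$ supports the initial point $z^0$, whose law is absolutely continuous with respect to Lebesgue measure on $\mathbb{R}^d$. $(\Omega_\xi,\mathcal{F}_\xi,\mathbb{P}_\xi)$ supports the $\Xi$-valued seed sequence $\{\xi^k\}_{k\ge0}$ (no independence among the $\xi^k$ is assumed). Everything lives on the product space $(\Omega,\mathcal{F},\mathbb{P})=(\Omega_0\times\Omega_\xi,\mathcal{F}_0\otimes\mathcal{F}_\xi,\mathbb{P}_0\otimes\mathbb{P}_\xi)$, so $z^0$ is independent of the seed sequence. The map $(z,\xi)\mapsto G(z;\xi)$ is jointly measurable, and for every $z^*\in\mathcal{Z}^*$ the map $(z,\xi)\mapsto \mathrm{D}G(z;\xi)$ (derivative in $z$) is jointly measurable on $\mathcal{U}_{z^*}\times\Xi$, with $\mathcal{U}_{z^*}$ as below. Structural assumption. (Regularity) $F$ is $\mathcal{C}^1$ in a neighborhood of $\mathcal{Z}^*$. (Local equicontinuity) For every $z^*\in\mathcal{Z}^*$ there is an open neighborhood $\mathcal{U}_{z^*}$ of $z^*$ such that $G(\cdot;\xi)$ is differentiable on $\mathcal{U}_{z^*}$ for every $\xi\in\Xi$, and for every compact $\mathcal{Q}\subset\mathcal{U}_{z^*}$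 and every $\varepsilon>0$ there is $\delta>0$ with $\|\mathrm{D}G(z;\xi)-\mathrm{D}G(w;\xi)\|\le\varepsilon$ for all $\xi\in\Xi$ and all $z,w\in\mathcal{Q}$ with $\|z-w\|\le\delta$. (Lipeomorphism) There is $\tilde\alpha>0$ such that for every $0<\alpha\le\tilde\alpha$ and every $\xi\in\Xi$ the map $T_{\alpha,\xi}(z):=z-\alpha G(z;\xi)$ has a well-defined inverse on $\mathbb{R}^d$ and both $T_{\alpha,\xi}$ and $T_{\alpha,\xi}^{-1}$ are locally Lipschitz. Stochastic oracle assumption. For every $\bar z\in\mathcal{Z}^*$, put $b_k:=G(\bar z;\xi^k)-F(\bar z)$, $J_k:=\mathrm{D}G(\bar z;\xi^k)-\mathrm{D}F(\bar z)$ and $S_k:=\sum_{i=k}^\infty\alpha_iJ_i$. There is an event $\mathcal{E}_{\rm reg}(\bar z)\in\mathcal{F}_\xi$ with $\mathbb{P}_\xi(\mathcal{E}_{\rm reg}(\bar z))=1$ on which the series defining $S_k$ converge, $S_k\to0$, $S_{k+1}J_k\to0$, and the series $\sum_{k=0}^\infty\alpha_kb_k$ and $\sum_{k=0}^\infty\alpha_kS_{k+1}b_k$ converge. *)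

theory Defs
  imports "HOL-Probability.Probability"
begin

definition complex_eigenvalue :: "real^'n^'n \<Rightarrow> complex \<Rightarrow> bool" where
  "complex_eigenvalue A \<mu> \<longleftrightarrow>
    (\<exists>v::complex^'n. v \<noteq> 0 \<and> map_matrix complex_of_real A *v v = \<mu> *s v)"

definition unstable_zeros :: "(real^'n \<Rightarrow> real^'n) \<Rightarrow> (real^'n) set" where
  "unstable_zeros F = {z. F z = 0 \<and> F differentiable (at z) \<and>
    (\<exists>\<mu>. complex_eigenvalue (jacobian F (at z)) \<mu> \<and> Re \<mu> < 0)}"

definition C1_near :: "(real^'n \<Rightarrow> real^'n) \<Rightarrow> (real^'n) set \<Rightarrow> bool" where
  "C1_near F Z \<longleftrightarrow> (\<exists>V. open V \<and> Z \<subseteq> V \<and>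
    (\<forall>z\<in>V. F differentiable (at z)) \<and> continuous_on V (\<lambda>z. jacobian F (at z)))"

text \<open>The derivative of an oracle in its first argument, at a given seed. As usual it is meaningful
  only at points where the oracle is differentiable.\<close>

definition D_oracle :: "(real^'n \<Rightarrow> 'x \<Rightarrow> real^'n) \<Rightarrow> real^'n \<Rightarrow> 'x \<Rightarrow> real^'n^'n" where
  "D_oracle G z x = jacobian (\<lambda>w. G w x) (at z)"

text \<open>The norm of a difference of derivatives is the operator norm (the norm of the matrix
  type itself would be the Frobenius norm).\<close>

definition locally_equicontinuous_derivative ::
  "'x set \<Rightarrow> (real^'n \<Rightarrow> 'x \<Rightarrow> real^'n) \<Rightarrow> (real^'n) set \<Rightarrow> bool" where
  "locally_equicontinuous_derivative X G U \<longleftrightarrow>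
    (\<forall>x\<in>X. \<forall>z\<in>U. (\<lambda>w. G w x) differentiable (at z)) \<and>
    (\<forall>Q \<epsilon>. compact Q \<and> Q \<subseteq> U \<and> \<epsilon> > 0 \<longrightarrow>
      (\<exists>\<delta>>0. \<forall>x\<in>X. \<forall>z\<in>Q. \<forall>w\<in>Q. norm (z - w) \<le> \<delta> \<longrightarrow>
        onorm ((*v) (D_oracle G z x - D_oracle G w x)) \<le> \<epsilon>))"

definition locally_lipschitz :: "(real^'n \<Rightarrow> real^'n) \<Rightarrow> bool" where
  "locally_lipschitz f \<longleftrightarrow> (\<forall>z. \<exists>r>0. \<exists>L. L-lipschitz_on (ball z r) f)"

definition oracle_step :: "(real^'n \<Rightarrow> 'x \<Rightarrow> real^'n) \<Rightarrow> real \<Rightarrow> 'x \<Rightarrow> real^'n \<Rightarrow> real^'n" where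
  "oracle_step G a x z = z - a *\<^sub>R G z x"

definition lipeomorphic_oracle ::
  "'x set \<Rightarrow> (real^'n \<Rightarrow> 'x \<Rightarrow> real^'n) \<Rightarrow> real \<Rightarrow> bool" where
  "lipeomorphic_oracle X G a_max \<longleftrightarrow> a_max > 0 \<and>
    (\<forall>a x. 0 < a \<and> a \<le> a_max \<and> x \<in> X \<longrightarrow>
      bij (oracle_step G a x) \<and>
      locally_lipschitz (oracle_step G a x) \<and> locally_lipschitz (inv (oracle_step G a x)))"

text \<open>Regularity of one realization x of the seed sequence at the point p. All series are
  ordinary (possibly only conditionally convergent) series.\<close>

definition regular_seeds ::
  "(real^'n \<Rightarrow> real^'n) \<Rightarrow> (real^'n \<Rightarrow> 'x \<Rightarrow> real^'n) \<Rightarrow> (nat \<Rightarrow> real) \<Rightarrow> real^'n \<Rightarrow> (nat \<Rightarrow> 'x) \<Rightarrow> bool"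
  where
  "regular_seeds F G \<alpha> p x \<longleftrightarrow>
    (let b = (\<lambda>k. G p (x k) - F p);
         J = (\<lambda>k. D_oracle G p (x k) - jacobian F (at p));
         S = (\<lambda>k. \<Sum>i. \<alpha> (k + i) *\<^sub>R J (k + i))
     in (\<forall>k. summable (\<lambda>i. \<alpha> (k + i) *\<^sub>R J (k + i))) \<and>
        S \<longlonglongrightarrow> 0 \<and>
        (\<lambda>k. S (Suc k) ** J k) \<longlonglongrightarrow> 0 \<and>
        summable (\<lambda>k. \<alpha> k *\<^sub>R b k) \<and>
        summable (\<lambda>k. \<alpha> k *\<^sub>R (S (Suc k) *v b k)))"

end

theory Submission
  imports Defs "HOL-Computational_Algebra.Fundamental_Theorem_Algebra"
begin

text \<open>Fix seeds that are regular at an unstable zero \<open>p\<close>. No invariant manifold is constructed: it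
  suffices to compare two orbits that stay in a small ball around \<open>p\<close> from some late time on. Their
  difference \<open>d\<^sub>k\<close> satisfies a linear recursion with a small relative error, and \<open>e\<^sub>k = (I - S\<^sub>k) d\<^sub>k\<close>
  satisfies \<open>e\<^sub>k\<^sub>+\<^sub>1 = e\<^sub>k - \<alpha>\<^sub>k (A e\<^sub>k + \<rho>\<^sub>k)\<close> with \<open>A = DF(p)\<close> and \<open>|\<rho>\<^sub>k| \<le> \<epsilon> |e\<^sub>k|\<close>. As \<open>-A\<close> has an
  eigenvalue with positive real part, there is a quadratic Lyapunov form \<open>h\<close> with \<open>h v v > 0\<close> for
  some \<open>v\<close> such that positive values of \<open>h e\<^sub>k e\<^sub>k\<close> grow by at least the factor \<open>1 + 2 \<gamma> \<alpha>\<^sub>k\<close>; since the step sizes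
  have infinite sum, two staying orbits cannot start at points that differ by a multiple of \<open>v\<close>.
  So all translates along \<open>v\<close> of the bounded set of staying points are disjoint, and it is null.
  The radius of the ball does not depend on the seeds; countably many such balls cover the unstable
  zeros, preimages of null sets under the steps are null, and Fubini's theorem concludes.\<close>

section \<open>Lyapunov forms for unstable matrices\<close>

lemma linear_relation_of_sequence:
  fixes v :: "nat \<Rightarrow> 'a::euclidean_space"
  obtains c :: "nat \<Rightarrow> real"
  where "\<exists>i\<le>DIM('a). c i \<noteq> 0" "(\<Sum>i\<le>DIM('a). c i *\<^sub>R v i) = 0"
proof (cases "inj_on v {..DIM('a)}")
  case True
  have "dependent (v ` {..DIM('a)})"
    using dependent_biggerset[of "v ` {..DIM('a)}"] True by (simp add: card_image)
  then obtain u where u: "\<exists>w\<in>v ` {..DIM('a)}. u w \<noteq> 0" "(\<Sum>w\<in>v ` {..DIM('a)}. u w *\<^sub>R w) = 0"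
    using dependent_finite[of "v ` {..DIM('a)}"] by auto
  show ?thesis
    by (rule that[of "u \<circ> v"]) (use u True in \<open>auto simp: sum.reindex\<close>)
next
  \<comment> \<open>Dependence is a property of sets, so a repeated vector would leave too few
    elements for the dimension count; here \<open>v i - v j = 0\<close> is itself the
    relation.\<close>
  case False
  then obtain i j where ij: "i \<le> DIM('a)" "j \<le> DIM('a)" "i \<noteq> j" "v i = v j"
    by (auto simp: inj_on_def)
  have "(\<Sum>k\<le>DIM('a). ((if k = i then 1 else 0) - (if k = j then 1 else 0)) *\<^sub>R v k)
      = (\<Sum>k\<le>DIM('a). (if k = i then v k else 0)) - (\<Sum>k\<le>DIM('a). (if k = j then v k else 0))"
    unfolding sum_subtractf[symmetric] by (rule sum.cong) (auto simp: scaleR_diff_left)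
  also have "\<dots> = 0" using ij by simp
  finally show ?thesis
    using ij by (intro that[of "\<lambda>k. (if k = i then 1 else 0) - (if k = j then 1 else 0)"]) auto
qed

text \<open>This is the vector p(C) y, built from iterates of \<open>C\<close> on
  \<open>y\<close>.\<close>

definition poly_apply :: "complex^'n^'n \<Rightarrow> complex poly \<Rightarrow> complex^'n \<Rightarrow> complex^'n" where
  "poly_apply C p y = (\<Sum>i\<le>degree p. coeff p i *s ((*v) C ^^ i) y)"

lemma poly_apply_eq_sum:
  assumes "degree p \<le> N"
  shows "poly_apply C p y = (\<Sum>i\<le>N. coeff p i *s ((*v) C ^^ i) y)"
  unfolding poly_apply_def
  by (rule sum.mono_neutral_left) (use assms in \<open>auto simp: coeff_eq_0\<close>)

lemma matrix_vector_mult_sum_right: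
  fixes C :: "complex^'n^'n"
  shows "C *v (\<Sum>i\<in>I. f i) = (\<Sum>i\<in>I. C *v f i)"
  by (induction I rule: infinite_finite_induct) (auto simp: matrix_vector_right_distrib)

lemma matrix_vector_mult_sum_left:
  fixes f :: "'i \<Rightarrow> complex^'n^'n"
  shows "(\<Sum>i\<in>I. f i) *v y = (\<Sum>i\<in>I. f i *v y)"
  by (induction I rule: infinite_finite_induct) (auto simp: matrix_vector_mult_add_rdistrib)

lemma scaleR_complex_vector: "complex_of_real c *s y = c *\<^sub>R y"
  by (simp add: vec_eq_iff scaleR_conv_of_real[where 'a=complex])

lemma scaleR_complex_matrix_vector_mult:
  fixes M :: "complex^'n^'n"
  shows "(c *\<^sub>R M) *v y = c *\<^sub>R (M *v y)"
  by (simp add: matrix_vector_mult_def vec_eq_iff scaleR_sum_right)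

text \<open>Multiplying a polynomial by the variable shifts its coefficients by one, which amounts
  to one more application of \<open>C\<close>. The coefficient shifted into place 0 is 0.\<close>

lemma poly_apply_linear_factor:
  "poly_apply C ([:-l, 1:] * q) y = C *v poly_apply C q y - l *s poly_apply C q y"
proof -
  define N where "N = degree q"
  define u where "u i = ((*v) C ^^ i) y" for i
  have d: "degree ([:-l, 1:] * q) \<le> Suc N"
    using degree_mult_le[of "[:-l, 1:]" q] by (simp add: N_def)
  have c: "coeff ([:-l, 1:] * q) i = (if i = 0 then 0 else coeff q (i - 1)) - l * coeff q i" for i
    by (auto simp: coeff_pCons split: nat.splits)
  have shift: "(\<Sum>i\<le>Suc N. (if i = 0 then 0 else coeff q (i - 1)) *s u i)
      = C *v (\<Sum>i\<le>N. coeff q i *s u i)"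
    by (subst sum.atMost_Suc_shift)
       (simp add: u_def matrix_vector_mult_sum_right vector_scalar_commute)
  have "poly_apply C ([:-l, 1:] * q) y
      = (\<Sum>i\<le>Suc N. coeff ([:-l, 1:] * q) i *s u i)"
    using poly_apply_eq_sum[OF d] by (simp add: u_def)
  also have "\<dots> = (\<Sum>i\<le>Suc N. (if i = 0 then 0 else coeff q (i - 1)) *s u i)
      - l *s (\<Sum>i\<le>Suc N. coeff q i *s u i)"
    unfolding c by (simp only: vec.scale_left_diff_distrib sum_subtractf vec.scale_sum_right
        vec.scale_scale)
  also have "(\<Sum>i\<le>Suc N. coeff q i *s u i) = (\<Sum>i\<le>N. coeff q i *s u i)"
    by (simp add: N_def coeff_eq_0)
  finally show ?thesis unfolding shift by (simp add: poly_apply_def N_def u_def)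
qed

text \<open>The product of the factors C - l applied to \<open>y\<close>, the head of the list
  acting last. This order makes each suffix of the list a partial product, on which the Lyapunov
  form is built.\<close>

fun linear_factors :: "complex^'n^'n \<Rightarrow> complex list \<Rightarrow> complex^'n \<Rightarrow> complex^'n" where
  "linear_factors C [] y = y"
| "linear_factors C (l # ls) y = C *v linear_factors C ls y - l *s linear_factors C ls y"

lemma poly_apply_prod_linear_factors:
  "poly_apply C (smult a (\<Prod>l\<leftarrow>ls. [:-l, 1:])) y = a *s linear_factors C ls y"
proof (induction ls)
  case Nil
  then show ?case by (simp add: poly_apply_def)
next
  case (Cons l ls)
  have "smult a (\<Prod>l\<leftarrow>l # ls. [:-l, 1:]) = [:-l, 1:] * smult a (\<Prod>l\<leftarrow>ls. [:-l, 1:])"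
    by (simp only: list.map prod_list.Cons mult_smult_right)
  then show ?case
    by (simp only: poly_apply_linear_factor Cons.IH linear_factors.simps vector_scalar_commute
        vec.scale_right_diff_distrib vec.scale_scale mult.commute)
qed

text \<open>The powers of \<open>C\<close> lie in a space of finite real dimension, so a nonzero
  polynomial kills \<open>C\<close>, and over the complex numbers it splits. This is a weak form of
  Cayley-Hamilton: the list may contain numbers that are not eigenvalues.\<close>

lemma annihilating_linear_factors:
  fixes C :: "complex^'n^'n"
  obtains ls where "\<And>y. linear_factors C ls y = 0"
proof -
  define P where "P i = ((**) C ^^ i) (mat 1)" for i
  have P: "P i *v y = ((*v) C ^^ i) y" for i y
    by (induction i) (auto simp: P_def matrix_vector_mul_assoc[symmetric])
  obtain c where c: "\<exists>i\<le>DIM(complex^'n^'n). c i \<noteq> 0" "(\<Sum>i\<le>DIM(complex^'n^'n). c i *\<^sub>R P i) = 0"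
    using linear_relation_of_sequence[of P] by metis
  define N where "N = DIM(complex^'n^'n)"
  define p where "p = (\<Sum>i\<le>N. monom (complex_of_real (c i)) i)"
  have coeff_p: "coeff p i = (if i \<le> N then of_real (c i) else 0)" for i
    unfolding p_def coeff_sum by (simp add: coeff_monom)
  have deg: "degree p \<le> N"
    by (rule degree_le) (auto simp: coeff_p)
  have "p \<noteq> 0"
    using c(1) coeff_p unfolding N_def[symmetric] by (metis coeff_0 of_real_eq_0_iff)
  have zero: "poly_apply C p y = 0" for y
  proof -
    have "poly_apply C p y = (\<Sum>i\<le>N. c i *\<^sub>R (P i *v y))"
      unfolding poly_apply_eq_sum[OF deg]
      by (rule sum.cong) (auto simp: coeff_p P scaleR_complex_vector)
    also have "\<dots> = (\<Sum>i\<le>N. c i *\<^sub>R P i) *v y"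
      by (simp add: matrix_vector_mult_sum_left scaleR_complex_matrix_vector_mult)
    finally show ?thesis using c(2) by (simp add: N_def)
  qed
  obtain root where r: "smult (lead_coeff p) (\<Prod>i<degree p. [:-root i, 1:]) = p"
    using complex_poly_decompose' by blast
  define ls where "ls = map root [0..<degree p]"
  have "(\<Prod>i<degree p. [:-root i, 1:]) = (\<Prod>l\<leftarrow>ls. [:-l, 1:])"
    by (simp add: ls_def comp_def prod.list_conv_set_nth atLeast0LessThan)
  then have "lead_coeff p *s linear_factors C ls y = 0" for y
    using r zero poly_apply_prod_linear_factors by metis
  then show thesis using \<open>p \<noteq> 0\<close> by (intro that[of ls]) simp
qed

section \<open>Quadratic Lyapunov forms and their growth\<close>

lemma inner_scaled_complex_vector:
  fixes y :: "complex^'n"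
  shows "y \<bullet> (l *s y) = Re l * (norm y)\<^sup>2"
proof -
  \<comment> \<open>The real inner product is the real part of the Hermitian one, so the imaginary
    part of \<open>l\<close> rotates each entry orthogonally and contributes nothing.\<close>
  have "y \<bullet> (l *s y) = (\<Sum>i\<in>UNIV. Re l * (y $ i \<bullet> y $ i))"
    unfolding inner_vec_def by (rule sum.cong) (auto simp: inner_complex_def algebra_simps)
  also have "\<dots> = Re l * (y \<bullet> y)" by (simp add: inner_vec_def sum_distrib_left)
  finally show ?thesis by (simp add: power2_norm_eq_inner)
qed

lemma linear_scale_complex_vector: "linear (\<lambda>y. l *s (y::complex^'n))"
  by (rule linearI) (auto simp: vec_eq_iff algebra_simps)

lemma linear_linear_factors: "linear (linear_factors C ls)"
proof (induction ls)
  case Nil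
  then show ?case by (simp add: linear_iff)
next
  case (Cons l ls)
  have "linear ((*v) C)" using matrix_vector_mul_bounded_linear bounded_linear.linear by blast
  then show ?case
    using Cons linear_scale_complex_vector[of l] linear_compose_sub[OF linear_compose[of "linear_factors C ls" "(*v) C"]
        linear_compose[of "linear_factors C ls" "\<lambda>y. l *s y"]]
    by (simp add: comp_def)
qed

lemma linear_factors_commute: "linear_factors C ls (C *v y) = C *v linear_factors C ls y"
  by (induction ls) (auto simp: matrix_vector_mult_diff_distrib vector_scalar_commute)

text \<open>The term indexed by a suffix of the list absorbs the error left by the previous one, since
  \<open>\<Psi> \<bullet> (C - \<gamma>) \<Psi> = (Re l - \<gamma>) |\<Psi>|\<^sup>2 + \<Psi> \<bullet> (C - l) \<Psi>\<close>.\<close>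

lemma lyapunov_form_up_to_linear_factors:
  fixes C :: "complex^'n^'n"
  assumes "\<forall>l\<in>set ls. Re l \<noteq> \<gamma>"
  shows "\<exists>h K. bilinear h \<and> (\<forall>x y. h x y = h y x) \<and>
    (\<forall>y. 2 * h y (C *v y) \<ge> 2 * \<gamma> * h y y + (norm y)\<^sup>2 - K * (norm (linear_factors C ls y))\<^sup>2) \<and> K \<ge> 0"
  using assms
proof (induction ls)
  case Nil
  \<comment> \<open>The empty product leaves \<open>y\<close> itself, so the zero form works with
    error constant 1.\<close>
  then show ?case
    by (intro exI[of _ "\<lambda>_ _. 0"] exI[of _ 1]) (auto simp: bilinear_def linear_iff)
next
  case (Cons l ls)
  then obtain h K where h: "bilinear h" "\<And>x y. h x y = h y x" "K \<ge> 0"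
    "\<And>y. 2 * h y (C *v y) \<ge> 2 * \<gamma> * h y y + (norm y)\<^sup>2 - K * (norm (linear_factors C ls y))\<^sup>2"
    by auto
  define D where "D = linear_factors C ls"
  define r where "r = Re l - \<gamma>"
  \<comment> \<open>The weight K / r turns (Re l - \<gamma>) |D y|^2 into K |D y|^2 whatever the
    sign of \<open>r\<close>. With the factor 2 this appears twice: one copy cancels the old error,
    the other completes a square with the cross term.\<close>
  define h' where "h' x y = h x y + (K / r) * (D x \<bullet> D y)" for x y
  have r: "r \<noteq> 0" using Cons.prems by (simp add: r_def)
  have lD: "linear D" using linear_linear_factors by (simp add: D_def)
  have lh: "linear (\<lambda>y. h x y)" "linear (\<lambda>x. h x y)" for x y
    using h(1) by (auto simp: bilinear_def)
  have "bilinear h'"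
    unfolding bilinear_def linear_iff h'_def
    by (auto simp: linear_add[OF lD] linear_scale[OF lD] linear_add[OF lh(1)] linear_scale[OF lh(1)]
        linear_add[OF lh(2)] linear_scale[OF lh(2)] algebra_simps inner_add_left inner_add_right)
  moreover have "h' x y = h' y x" for x y
    by (simp add: h'_def h(2)[of x y] inner_commute)
  moreover have "2 * h' y (C *v y) \<ge> 2 * \<gamma> * h' y y + (norm y)\<^sup>2
      - (K / r\<^sup>2) * (norm (linear_factors C (l # ls) y))\<^sup>2" for y
  proof -
    define u where "u = D y"
    define w where "w = C *v u - l *s u"
    have "D (C *v y) = w + l *s u"
      by (simp add: w_def u_def D_def linear_factors_commute)
    then have 1: "D y \<bullet> D (C *v y) = u \<bullet> w + (r + \<gamma>) * (norm u)\<^sup>2"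
      by (simp add: u_def[symmetric] inner_add_right inner_scaled_complex_vector r_def)
    \<comment> \<open>Completing the square trades the cross term for |w|^2 / r^2, and
      \<open>w\<close> is the longer product applied to \<open>y\<close>: this is the new error,
      with constant K / r^2.\<close>
    have "0 \<le> (norm (u + (1 / r) *\<^sub>R w))\<^sup>2" by simp
    also have "\<dots> = (norm u)\<^sup>2 + (2 / r) * (u \<bullet> w) + (1 / r\<^sup>2) * (norm w)\<^sup>2"
      unfolding power2_norm_eq_inner
      by (simp add: inner_add_left inner_add_right inner_commute power2_eq_square)
    finally have 2: "K * ((norm u)\<^sup>2 + (2 / r) * (u \<bullet> w) + (1 / r\<^sup>2) * (norm w)\<^sup>2) \<ge> 0"
      using h(3) by simp
    have 3: "2 * h' y (C *v y) = 2 * h y (C *v y) + 2 * (K / r) * (u \<bullet> w) + 2 * K * (norm u)\<^sup>2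
        + 2 * \<gamma> * (K / r) * (norm u)\<^sup>2"
      unfolding h'_def 1 using r by (simp add: field_simps)
    have 4: "2 * \<gamma> * h' y y = 2 * \<gamma> * h y y + 2 * \<gamma> * (K / r) * (norm u)\<^sup>2"
      unfolding h'_def by (simp add: u_def power2_norm_eq_inner algebra_simps)
    have 5: "linear_factors C (l # ls) y = w" by (simp add: w_def u_def D_def)
    show ?thesis
      using h(4)[of y] 2 unfolding 3 4 5 D_def[symmetric] u_def[symmetric]
      by (simp add: algebra_simps)
  qed
  ultimately show ?case
    using h(3) by (intro exI[of _ h'] exI[of _ "K / r\<^sup>2"]) auto
qed

text \<open>Once the list of factors annihilates the matrix, the error term disappears. Restricting
  the complex form to real vectors keeps the inequality, and positivity somewhere comes from the
  real and imaginary parts of the unstable eigenvector.\<close>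

lemma lyapunov_form_unstable:
  fixes A :: "real^'n^'n"
  assumes ev: "complex_eigenvalue A \<mu>" and "Re \<mu> > 0"
  obtains h \<gamma> v where "bilinear h" "\<And>x y. h x y = h y x" "\<gamma> > 0" "h v v > 0"
    "\<And>y. 2 * h y (A *v y) \<ge> 2 * \<gamma> * h y y + (norm y)\<^sup>2"
proof -
  define C where "C = map_matrix complex_of_real A"
  define J where "J x = (\<chi> i. complex_of_real (x $ i))" for x :: "real^'n"
  have lJ: "linear J" unfolding linear_iff by (simp add: J_def vec_eq_iff scaleR_conv_of_real[where 'a=complex])
  have CJ: "C *v J x = J (A *v x)" for x
    by (simp add: C_def J_def matrix_vector_mult_def map_matrix_def vec_eq_iff)
  have nJ: "norm (J x) = norm x" for x by (simp add: J_def norm_vec_def)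
  obtain ls where ls: "\<And>y. linear_factors C ls y = 0" using annihilating_linear_factors by blast
  \<comment> \<open>The rate \<gamma> must lie below Re \<mu> to give positivity, and off the
    finitely many real parts in \<open>ls\<close> for the form to exist.\<close>
  have "infinite ({0<..<Re \<mu>} - Re ` set ls)"
    using infinite_Ioo[OF \<open>Re \<mu> > 0\<close>] by (intro Diff_infinite_finite) auto
  then have "{0<..<Re \<mu>} - Re ` set ls \<noteq> {}"
    using infinite_imp_nonempty by blast
  then obtain \<gamma> where \<gamma>: "0 < \<gamma>" "\<gamma> < Re \<mu>" "\<gamma> \<notin> Re ` set ls"
    by (metis DiffE equals0I greaterThanLessThan_iff)
  obtain H K where H: "bilinear H" "\<And>x y. H x y = H y x"
    "\<And>y. 2 * H y (C *v y) \<ge> 2 * \<gamma> * H y y + (norm y)\<^sup>2 - K * (norm (linear_factors C ls y))\<^sup>2"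
    using lyapunov_form_up_to_linear_factors[of ls \<gamma> C] \<gamma>(3) by blast
  define h where "h x y = H (J x) (J y)" for x y
  have lh: "linear (\<lambda>y. H x y)" "linear (\<lambda>x. H x y)" for x y
    using H(1) by (auto simp: bilinear_def)
  have bil: "bilinear h" unfolding bilinear_def linear_iff h_def
    by (auto simp: linear_add[OF lJ] linear_scale[OF lJ] linear_add[OF lh(1)] linear_scale[OF lh(1)]
        linear_add[OF lh(2)] linear_scale[OF lh(2)])
  have sym: "h x y = h y x" for x y unfolding h_def by (rule H(2))
  have lyap: "2 * h y (A *v y) \<ge> 2 * \<gamma> * h y y + (norm y)\<^sup>2" for y
    using H(3)[of "J y"] by (simp add: h_def CJ ls nJ)
  obtain x where x: "x \<noteq> 0" "C *v x = \<mu> *s x"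
    using ev by (auto simp: complex_eigenvalue_def C_def)
  define u w where "u = (\<chi> i. Re (x $ i))" and "w = (\<chi> i. Im (x $ i))"
  have "Re ((C *v x) $ i) = (A *v u) $ i" "Im ((C *v x) $ i) = (A *v w) $ i" for i
    by (auto simp: C_def u_def w_def matrix_vector_mult_def map_matrix_def)
  then have A: "A *v u = Re \<mu> *\<^sub>R u - Im \<mu> *\<^sub>R w" "A *v w = Re \<mu> *\<^sub>R w + Im \<mu> *\<^sub>R u"
    unfolding x(2) by (auto simp: vec_eq_iff u_def w_def)
  have "u \<noteq> 0 \<or> w \<noteq> 0"
    using x(1) by (auto simp: u_def w_def vec_eq_iff complex_eq_iff)
  then have pos: "(norm u)\<^sup>2 + (norm w)\<^sup>2 > 0"
    by (auto intro: add_pos_nonneg add_nonneg_pos)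
  \<comment> \<open>Adding the inequalities at \<open>u\<close> and \<open>w\<close> makes the two
    Im \<mu> terms cancel by symmetry of \<open>h\<close>, leaving a multiple of
    \<open>h u u + h w w\<close>.\<close>
  have "2 * \<gamma> * (h u u + h w w) + ((norm u)\<^sup>2 + (norm w)\<^sup>2) \<le> 2 * (h u (A *v u) + h w (A *v w))"
    using lyap[of u] lyap[of w] by (simp add: algebra_simps)
  also have "h u (A *v u) + h w (A *v w) = Re \<mu> * (h u u + h w w)"
    unfolding A using sym[of u w]
    by (simp add: bilinear_rsub[OF bil] bilinear_radd[OF bil] bilinear_rmul[OF bil] algebra_simps)
  finally have "0 < 2 * (Re \<mu> - \<gamma>) * (h u u + h w w)"
    using pos by (simp add: algebra_simps)
  then have "h u u + h w w > 0"
    using \<gamma>(2) by (simp add: zero_less_mult_iff)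
  then have "h u u > 0 \<or> h w w > 0" by linarith
  then show thesis using that bil sym \<gamma>(1) lyap by blast
qed

text \<open>The surplus |y|^2 in the Lyapunov inequality pays for everything else: one half for the
  perturbation, one half for the term of second order in the step size. Hence positive values of the
  form grow without bound along divergent step sums.\<close>

lemma lyapunov_form_grows:
  fixes h :: "'a::euclidean_space \<Rightarrow> 'a \<Rightarrow> real" and B :: "'a \<Rightarrow> 'a"
  assumes h: "bilinear h" "\<And>x y. h x y = h y x"
    and lyap: "\<And>y. 2 * h y (B y) \<ge> 2 * \<gamma> * h y y + (norm y)\<^sup>2"
    and "\<gamma> > 0" and "linear B"
  obtains \<epsilon> where "\<epsilon> > 0"
    "\<And>a e \<rho>. (\<And>k. 0 < a k \<and> a k \<le> \<epsilon>) \<Longrightarrow> (\<And>k. norm (\<rho> k) \<le> \<epsilon> * norm (e k))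
      \<Longrightarrow> (\<And>k::nat. e (Suc k) = e k + a k *\<^sub>R (B (e k) + \<rho> k)) \<Longrightarrow> h (e 0) (e 0) > 0
      \<Longrightarrow> filterlim (\<lambda>n. \<Sum>k<n. a k) at_top sequentially \<Longrightarrow> \<not> bounded (range e)"
proof -
  obtain M where M: "M > 0" "\<And>x y. \<bar>h x y\<bar> \<le> M * norm x * norm y"
    using bilinear_bounded_pos[OF h(1)] by (metis real_norm_def)
  obtain L where L: "L > 0" "\<And>x. norm (B x) \<le> L * norm x"
    using linear_bounded_pos[OF \<open>linear B\<close>] by auto
  \<comment> \<open>The three bounds serve, in order, to get |r| \<le> |x| and so |B x + r| \<le> (L
    + 1) |x|, to keep 2 |h x r| below |x|^2 / 2, and to keep the second-order term below |x|^2 /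
    2.\<close>
  define \<epsilon> where "\<epsilon> = min 1 (min (1 / (4 * M)) (1 / (2 * M * (L + 1)\<^sup>2)))"
  have \<epsilon>: "\<epsilon> > 0" "\<epsilon> \<le> 1" "2 * M * \<epsilon> \<le> 1 / 2" "\<epsilon> * (M * (L + 1)\<^sup>2) \<le> 1 / 2"
  proof -
    show "\<epsilon> > 0" "\<epsilon> \<le> 1" using M(1) L(1) by (auto simp: \<epsilon>_def)
    have "\<epsilon> \<le> 1 / (4 * M)" "\<epsilon> \<le> 1 / (2 * M * (L + 1)\<^sup>2)" by (auto simp: \<epsilon>_def)
    then show "2 * M * \<epsilon> \<le> 1 / 2" "\<epsilon> * (M * (L + 1)\<^sup>2) \<le> 1 / 2"
      using M(1) L(1) by (auto simp: field_simps)
  qed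
  have step: "h (x + a *\<^sub>R (B x + r)) (x + a *\<^sub>R (B x + r)) \<ge> (1 + 2 * \<gamma> * a) * h x x"
    if a: "0 < a" "a \<le> \<epsilon>" and r: "norm r \<le> \<epsilon> * norm x" for x r a
  proof -
    define y where "y = B x + r"
    have "norm r \<le> 1 * norm x"
      using r \<epsilon>(2) by (meson mult_right_mono norm_ge_zero order_trans)
    then have y: "norm y \<le> (L + 1) * norm x"
      using norm_triangle_ineq[of "B x" r] L(2)[of x] by (simp add: y_def algebra_simps)
    have "\<bar>h y y\<bar> \<le> M * ((L + 1) * norm x)\<^sup>2"
      using M(2)[of y y] power_mono[OF y, of 2] M(1)
      by (smt (verit) mult_left_mono norm_ge_zero power2_eq_square mult.assoc)
    then have "a * \<bar>h y y\<bar> \<le> \<epsilon> * (M * ((L + 1) * norm x)\<^sup>2)"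
      using a by (intro mult_mono) auto
    also have "\<dots> = (\<epsilon> * (M * (L + 1)\<^sup>2)) * (norm x)\<^sup>2" by (simp add: power_mult_distrib)
    also have "\<dots> \<le> 1 / 2 * (norm x)\<^sup>2" by (intro mult_right_mono \<epsilon>(4)) auto
    finally have 1: "a * h y y \<ge> - (1 / 2 * (norm x)\<^sup>2)"
      using a(1) by (smt (verit) abs_mult minus_mult_right mult_left_mono)
    have "\<bar>h x r\<bar> \<le> M * norm x * (\<epsilon> * norm x)"
      using M(2)[of x r] r M(1) by (smt (verit) mult_left_mono mult_nonneg_nonneg norm_ge_zero)
    then have "2 * \<bar>h x r\<bar> \<le> (2 * M * \<epsilon>) * (norm x)\<^sup>2" by (simp add: power2_eq_square algebra_simps)
    also have "\<dots> \<le> 1 / 2 * (norm x)\<^sup>2" by (intro mult_right_mono \<epsilon>(3)) auto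
    finally have 2: "2 * h x r \<ge> - (1 / 2 * (norm x)\<^sup>2)" by linarith
    have "2 * h x y = 2 * h x (B x) + 2 * h x r" by (simp add: y_def bilinear_radd[OF h(1)])
    then have "2 * h x y + a * h y y \<ge> 2 * \<gamma> * h x x"
      using 1 2 lyap[of x] by linarith
    then have "a * (2 * h x y + a * h y y) \<ge> a * (2 * \<gamma> * h x x)"
      using a(1) by (intro mult_left_mono) auto
    moreover have "h (x + a *\<^sub>R y) (x + a *\<^sub>R y) = h x x + a * (2 * h x y + a * h y y)"
      using h(2)[of x y]
      by (simp add: bilinear_radd[OF h(1)] bilinear_ladd[OF h(1)] bilinear_rmul[OF h(1)]
          bilinear_lmul[OF h(1)] algebra_simps)
    ultimately show ?thesis unfolding y_def[symmetric] by (simp add: algebra_simps)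
  qed
  show thesis
  proof (rule that[OF \<epsilon>(1)])
    fix a :: "nat \<Rightarrow> real" and e \<rho> :: "nat \<Rightarrow> 'a"
    assume a: "\<And>k. 0 < a k \<and> a k \<le> \<epsilon>" and \<rho>: "\<And>k. norm (\<rho> k) \<le> \<epsilon> * norm (e k)"
      and e: "\<And>k. e (Suc k) = e k + a k *\<^sub>R (B (e k) + \<rho> k)" and e0: "h (e 0) (e 0) > 0"
      and div: "filterlim (\<lambda>n. \<Sum>k<n. a k) at_top sequentially"
    define q where "q = h (e 0) (e 0)"
    \<comment> \<open>A bound linear in the step sum suffices in place of the product of growth
      factors: the form never drops below \<open>q\<close>, so step n adds at least 2 \<gamma> (a n)
      q.\<close>
    have grow: "h (e n) (e n) \<ge> q * (1 + 2 * \<gamma> * (\<Sum>k<n. a k))" for n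
    proof (induction n)
      case 0
      then show ?case by (simp add: q_def)
    next
      case (Suc n)
      have s: "(\<Sum>k<n. a k) \<ge> 0" using a by (simp add: sum_nonneg less_imp_le)
      then have "q * (1 + 2 * \<gamma> * (\<Sum>k<n. a k)) \<ge> q * 1"
        using e0 \<open>\<gamma> > 0\<close> by (intro mult_left_mono) (auto simp: q_def)
      then have "h (e n) (e n) \<ge> q" using Suc by simp
      then have "2 * \<gamma> * a n * h (e n) (e n) \<ge> 2 * \<gamma> * a n * q"
        using a[of n] \<open>\<gamma> > 0\<close> by (intro mult_left_mono) auto
      then show ?case
        using step[of "a n" "\<rho> n" "e n"] a[of n] \<rho>[of n] Suc by (simp add: e algebra_simps)
    qed
    show "\<not> bounded (range e)"
    proof
      assume "bounded (range e)"
      then obtain R where R: "R > 0" "\<And>n. norm (e n) \<le> R"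
        by (auto simp: bounded_pos)
      have upper: "h (e n) (e n) \<le> M * R * R" for n
        using M(2)[of "e n" "e n"] R(2)[of n] M(1) R(1)
        by (smt (verit) mult_mono mult_nonneg_nonneg norm_ge_zero)
      obtain n where "(\<Sum>k<n. a k) \<ge> M * R * R / (2 * \<gamma> * q)"
        using div unfolding filterlim_at_top by (meson eventually_sequentially order_refl)
      then have "2 * \<gamma> * q * (\<Sum>k<n. a k) \<ge> M * R * R"
        using e0 \<open>\<gamma> > 0\<close> by (simp add: field_simps q_def)
      then show False using grow[of n] upper[of n] e0 by (simp add: q_def algebra_simps)
    qed
  qed
qed

section \<open>Points staying near an unstable zero\<close>

text \<open>Infinitely many disjoint translates of equal measure fit into one ball of finite
  measure, which forces that measure to be 0.\<close>

lemma negligible_if_translates_disjoint: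
  fixes S :: "'a::euclidean_space set"
  assumes "bounded S" and S: "S \<in> sets lebesgue"
    and inj: "\<And>y t. y \<in> S \<Longrightarrow> y + t *\<^sub>R v \<in> S \<Longrightarrow> t = 0"
  shows "negligible S"
proof -
  \<comment> \<open>Distinct shifts in the unit interval keep all translates in a common
    ball.\<close>
  define t where "t n = 1 / (real n + 1)" for n :: nat
  define T where "T n = (+) (t n *\<^sub>R v) ` S" for n
  have t: "0 \<le> t n" "t n \<le> 1" for n by (auto simp: t_def)
  have meas: "T n \<in> sets lebesgue" for n
    unfolding T_def using S by (rule lebesgue_sets_translation)
  have disj: "disjoint_family T"
    unfolding disjoint_family_on_def
  proof (intro ballI impI)
    fix m n :: nat assume "m \<noteq> n"
    show "T m \<inter> T n = {}"
    proof (rule ccontr)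
      assume "T m \<inter> T n \<noteq> {}"
      then obtain x y where xy: "x \<in> S" "y \<in> S" "t m *\<^sub>R v + x = t n *\<^sub>R v + y"
        by (auto simp: T_def)
      then have "y = x + (t m - t n) *\<^sub>R v" by (simp add: algebra_simps)
      then have "t m = t n" using inj[of x "t m - t n"] xy by simp
      then show False using \<open>m \<noteq> n\<close> by (simp add: t_def)
    qed
  qed
  obtain R where R: "\<And>x. x \<in> S \<Longrightarrow> norm x \<le> R" using \<open>bounded S\<close> by (auto simp: bounded_iff)
  have sub: "(\<Union>n. T n) \<subseteq> cball 0 (R + norm v)"
  proof safe
    fix n x assume "x \<in> T n"
    then obtain y where y: "y \<in> S" "x = t n *\<^sub>R v + y" by (auto simp: T_def)
    have "norm x \<le> t n * norm v + norm y"
      using norm_triangle_ineq[of "t n *\<^sub>R v" y] t[of n] y by simp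
    also have "\<dots> \<le> norm v + R"
      using R[OF y(1)] t[of n] by (simp add: add_mono mult_left_le_one_le)
    finally show "x \<in> cball 0 (R + norm v)" by simp
  qed
  have eq: "emeasure lebesgue (T n) = emeasure lebesgue S" for n
    using emeasure_lebesgue_affine[of 1 "t n *\<^sub>R v" S] by (simp add: T_def image_def add.commute[of "t n *\<^sub>R v"])
  have "(\<Sum>n. emeasure lebesgue S) = emeasure lebesgue (\<Union>n. T n)"
    using suminf_emeasure[of T lebesgue] meas disj eq by (simp add: image_subset_iff)
  also have "\<dots> \<le> emeasure lebesgue (cball 0 (R + norm v) :: 'a set)"
    by (rule emeasure_mono[OF sub]) auto
  also have "\<dots> < \<infinity>" using emeasure_compact_finite[of "cball 0 (R + norm v) :: 'a set"] by (simp add: emeasure_completion)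
  finally have fin: "(\<Sum>n::nat. emeasure lebesgue S) < \<infinity>" .
  have "emeasure lebesgue S = 0"
  proof (rule ccontr)
    assume "emeasure lebesgue S \<noteq> 0"
    have "(\<Sum>n::nat. emeasure lebesgue S)
        = (\<integral>\<^sup>+n. emeasure lebesgue S \<partial>count_space (UNIV::nat set))"
      by (rule nn_integral_count_space_nat[symmetric])
    also have "\<dots> = \<infinity>"
      using \<open>emeasure lebesgue S \<noteq> 0\<close> by (simp add: ennreal_mult_eq_top_iff)
    finally show False using fin by simp
  qed
  then show ?thesis using S by (simp add: negligible_iff_null_sets null_sets_def)
qed

section \<open>Orbits of time-dependent maps and linearization of the steps\<close>

primrec orbit :: "(nat \<Rightarrow> 'a \<Rightarrow> 'a) \<Rightarrow> nat \<Rightarrow> 'a \<Rightarrow> 'a" where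
  "orbit T 0 y = y"
| "orbit T (Suc n) y = T n (orbit T n y)"

text \<open>The maps depend on time, so restarting at time \<open>K\<close> also shifts the family
  of maps.\<close>

lemma orbit_add: "orbit T (K + n) y = orbit (\<lambda>n. T (K + n)) n (orbit T K y)"
  by (induction n) auto

lemma continuous_on_orbit:
  assumes "\<And>k. continuous_on UNIV (T k)"
  shows "continuous_on UNIV (orbit T n)"
proof (induction n)
  case (Suc n)
  then show ?case
    using continuous_on_compose2[OF assms, of UNIV "orbit T n" n] by simp
qed simp

lemma partial_sums_shift_at_top:
  fixes \<alpha> :: "nat \<Rightarrow> real"
  assumes "filterlim (\<lambda>n. \<Sum>k<n. \<alpha> k) at_top sequentially"
  shows "filterlim (\<lambda>n. \<Sum>k<n. \<alpha> (K + k)) at_top sequentially"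
proof -
  have eq: "(\<Sum>k<n. \<alpha> (K + k)) = - (\<Sum>k<K. \<alpha> k) + (\<Sum>k<n + K. \<alpha> k)" for n
    by (induction n) (auto simp: add.commute)
  have "filterlim (\<lambda>n. \<Sum>k<n + K. \<alpha> k) at_top sequentially"
    using filterlim_compose[OF assms filterlim_add_const_nat_at_top] .
  then show ?thesis
    unfolding eq by (intro filterlim_tendsto_add_at_top[OF tendsto_const])
qed

lemma bilinear_matrix_vector_mult: "bilinear ((*v) :: real^'n^'m \<Rightarrow> real^'n \<Rightarrow> real^'m)"
  unfolding bilinear_def linear_iff
  by (simp add: matrix_vector_right_distrib matrix_vector_mult_add_rdistrib
      matrix_vector_mult_scaleR scaleR_matrix_vector_assoc)

lemma complex_eigenvalue_uminus:
  assumes "complex_eigenvalue A \<mu>"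
  shows "complex_eigenvalue (- A) (- \<mu>)"
proof -
  obtain v where v: "v \<noteq> 0" "map_matrix complex_of_real A *v v = \<mu> *s v"
    using assms by (auto simp: complex_eigenvalue_def)
  have "map_matrix complex_of_real (- A) *v v = - (map_matrix complex_of_real A *v v)"
    by (simp add: matrix_vector_mult_def map_matrix_def vec_eq_iff sum_negf)
  then show ?thesis using v unfolding complex_eigenvalue_def by (intro exI[of _ v]) simp
qed

text \<open>Mean value inequality for the oracle minus its linear part at \<open>p\<close>, whose
  derivative is small near \<open>p\<close> by equicontinuity. The radius is chosen before the
  seed.\<close>

lemma oracle_linearization_error:
  fixes G :: "real^'n \<Rightarrow> 'x \<Rightarrow> real^'n"
  assumes "open U" "p \<in> U" and eq: "locally_equicontinuous_derivative X G U" and "\<eta> > 0"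
  obtains r where "r > 0" "\<And>x y w. x \<in> X \<Longrightarrow> y \<in> cball p r \<Longrightarrow> w \<in> cball p r \<Longrightarrow>
    norm (G y x - G w x - D_oracle G p x *v (y - w)) \<le> \<eta> * norm (y - w)"
proof -
  obtain r0 where r0: "r0 > 0" "cball p r0 \<subseteq> U"
    using \<open>open U\<close> \<open>p \<in> U\<close> open_contains_cball by blast
  obtain \<delta> where \<delta>: "\<delta> > 0" "\<And>x z w. x \<in> X \<Longrightarrow> z \<in> cball p r0 \<Longrightarrow> w \<in> cball p r0 \<Longrightarrow>
      norm (z - w) \<le> \<delta> \<Longrightarrow> onorm ((*v) (D_oracle G z x - D_oracle G w x)) \<le> \<eta>"
    using eq r0(2) \<open>\<eta> > 0\<close> compact_cball unfolding locally_equicontinuous_derivative_def by metis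
  \<comment> \<open>Radius \<open>r0\<close> keeps the ball inside \<open>U\<close>, and \<delta>
    keeps each of its points close enough to the centre \<open>p\<close> to compare derivatives
    there.\<close>
  define r where "r = min r0 \<delta>"
  have r: "r > 0" "cball p r \<subseteq> cball p r0" using r0(1) \<delta>(1) by (auto simp: r_def)
  show thesis
  proof (rule that[OF r(1)])
    fix x y w assume x: "x \<in> X" and yw: "y \<in> cball p r" "w \<in> cball p r"
    have der: "((\<lambda>w. G w x - D_oracle G p x *v w) has_derivative
        (*v) (D_oracle G z x - D_oracle G p x)) (at z within cball p r)" if "z \<in> cball p r" for z
    proof -
      have "(\<lambda>w. G w x) differentiable (at z)"
        using eq x that r(2) r0(2) unfolding locally_equicontinuous_derivative_def by blast
      then have "((\<lambda>w. G w x) has_derivative (*v) (D_oracle G z x)) (at z)"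
        unfolding D_oracle_def using jacobian_works by auto
      moreover have "((*v) (D_oracle G p x) has_derivative (*v) (D_oracle G p x)) (at z)"
        by (rule bounded_linear_imp_has_derivative) simp
      ultimately have "((\<lambda>w. G w x - D_oracle G p x *v w) has_derivative
          (\<lambda>h. D_oracle G z x *v h - D_oracle G p x *v h)) (at z)"
        by (rule has_derivative_diff)
      then show ?thesis
        by (simp add: matrix_vector_mult_diff_rdistrib[abs_def] has_derivative_at_withinI)
    qed
    have bound: "onorm ((*v) (D_oracle G z x - D_oracle G p x)) \<le> \<eta>" if "z \<in> cball p r" for z
      using \<delta>(2)[OF x, of z p] that r0(1) by (auto simp: r_def dist_norm norm_minus_commute)
    have "norm ((G y x - D_oracle G p x *v y) - (G w x - D_oracle G p x *v w)) \<le> \<eta> * norm (y - w)"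
      by (rule differentiable_bound[OF convex_cball der bound yw])
    then show "norm (G y x - G w x - D_oracle G p x *v (y - w)) \<le> \<eta> * norm (y - w)"
      by (simp add: matrix_vector_mult_diff_distrib algebra_simps)
  qed
qed

text \<open>The conditionally summable noise \<open>\<alpha>\<^sub>k J\<^sub>k = S\<^sub>k - S\<^sub>k\<^sub>+\<^sub>1\<close> in the recursion for the difference \<open>d\<^sub>k\<close>
  of two orbits is removed by passing to \<open>(I - S\<^sub>k) d\<^sub>k\<close>; the noise at the zero itself cancels in
  the difference.\<close>

lemma noise_removal_identity:
  fixes A J S S' :: "real^'n^'n"
  assumes "S - S' = a *\<^sub>R J" and d': "d' = d - a *\<^sub>R ((A + J) *v d + R)"
  shows "d' - S' *v d' = (d - S *v d) + a *\<^sub>R ((- A) *v (d - S *v d) +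
    (- (A *v (S *v d)) - R + S' *v (A *v d) + (S' ** J) *v d + S' *v R))"
proof -
  have aJ: "a *\<^sub>R (J *v d) = S *v d - S' *v d"
    using assms(1) by (metis matrix_vector_mult_diff_rdistrib scaleR_matrix_vector_assoc)
  have d'': "d' = d - a *\<^sub>R (A *v d) - (S *v d - S' *v d) - a *\<^sub>R R"
    unfolding d' aJ[symmetric] by (simp add: matrix_vector_mult_add_rdistrib algebra_simps)
  \<comment> \<open>Replacing S by S' costs this product of two noise terms, which is why S_{k+1}
    J_k must tend to 0.\<close>
  have S': "S' *v (S *v d - S' *v d) = a *\<^sub>R ((S' ** J) *v d)"
    unfolding aJ[symmetric] by (simp add: matrix_vector_mult_scaleR matrix_vector_mul_assoc)
  have "S' *v d' = S' *v d - a *\<^sub>R (S' *v (A *v d)) - a *\<^sub>R ((S' ** J) *v d) - a *\<^sub>R (S' *v R)"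
    unfolding d'' S'[symmetric]
    by (simp add: matrix_vector_mult_diff_distrib matrix_vector_mult_scaleR)
  moreover have "(- A) *v y = - (A *v y)" for y
    using matrix_vector_mult_diff_rdistrib[of 0 A y] by simp
  ultimately show ?thesis
    unfolding d'' by (simp add: matrix_vector_mult_diff_distrib algebra_simps)
qed

text \<open>The order of choices matters: the form and \<epsilon> come from the derivative at
  \<open>p\<close>, then \<open>r\<close> from equicontinuity, and only then the seeds are fixed.
  Thus \<open>r\<close> serves all regular seed sequences, while \<open>K0\<close> depends on the
  sequence.\<close>

lemma stay_set_negligible:
  fixes F :: "real^'n \<Rightarrow> real^'n" and G :: "real^'n \<Rightarrow> 'x \<Rightarrow> real^'n"
  assumes p: "p \<in> unstable_zeros F"
    and U: "open U" "p \<in> U" "locally_equicontinuous_derivative X G U"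
    and \<alpha>: "\<And>k. \<alpha> k > 0" "\<alpha> \<longlonglongrightarrow> 0" "filterlim (\<lambda>n. \<Sum>k<n. \<alpha> k) at_top sequentially"
  obtains r where "r > 0" "\<And>x. (\<And>k. x k \<in> X) \<Longrightarrow>
      (\<And>k. continuous_on UNIV (oracle_step G (\<alpha> k) (x k))) \<Longrightarrow> regular_seeds F G \<alpha> p x \<Longrightarrow>
      \<exists>K0. \<forall>K\<ge>K0. negligible {y. \<forall>n.
        orbit (\<lambda>n. oracle_step G (\<alpha> (K + n)) (x (K + n))) n y \<in> cball p r}"
proof -
  define A where "A = jacobian F (at p)"
  obtain \<mu> where \<mu>: "complex_eigenvalue A \<mu>" "Re \<mu> < 0"
    using p by (auto simp: unstable_zeros_def A_def)
  \<comment> \<open>The recursion moves along -A, for which the eigenvalue -\<mu> has positive real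
    part.\<close>
  obtain h \<gamma> v where h: "bilinear h" "\<And>x y. h x y = h y x" and \<gamma>: "\<gamma> > 0" and hv: "h v v > 0"
    and lyap: "\<And>y. 2 * h y ((- A) *v y) \<ge> 2 * \<gamma> * h y y + (norm y)\<^sup>2"
    using lyapunov_form_unstable[OF complex_eigenvalue_uminus[OF \<mu>(1)]] \<mu>(2) by auto
  have "linear ((*v) (- A))" by (rule bounded_linear.linear) simp
  then obtain \<epsilon> where "\<epsilon> > 0" and escape:
    "\<And>a e \<rho>. (\<And>k. 0 < a k \<and> a k \<le> \<epsilon>) \<Longrightarrow> (\<And>k. norm (\<rho> k) \<le> \<epsilon> * norm (e k))
      \<Longrightarrow> (\<And>k::nat. e (Suc k) = e k + a k *\<^sub>R ((- A) *v e k + \<rho> k)) \<Longrightarrow> h (e 0) (e 0) > 0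
      \<Longrightarrow> filterlim (\<lambda>n. \<Sum>k<n. a k) at_top sequentially \<Longrightarrow> \<not> bounded (range e)"
    using lyapunov_form_grows[where h=h and B="(*v) (- A)" and \<gamma>=\<gamma>] h lyap \<gamma> by blast
  obtain c where c: "c > 0" "\<And>(M::real^'n^'n) y. norm (M *v y) \<le> c * norm M * norm y"
    using bilinear_bounded_pos[OF bilinear_matrix_vector_mult] by blast
  obtain r where r: "r > 0" and lin: "\<And>x y w. x \<in> X \<Longrightarrow> y \<in> cball p r \<Longrightarrow> w \<in> cball p r \<Longrightarrow>
    norm (G y x - G w x - D_oracle G p x *v (y - w)) \<le> \<epsilon> / 8 * norm (y - w)"
    using oracle_linearization_error[OF U, of "\<epsilon> / 8"] \<open>\<epsilon> > 0\<close> by auto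
  show thesis
  proof (rule that[OF r])
    fix x
    assume seeds: "\<And>k. x k \<in> X" and cont: "\<And>k. continuous_on UNIV (oracle_step G (\<alpha> k) (x k))"
      and reg: "regular_seeds F G \<alpha> p x"
    define J where "J k = D_oracle G p (x k) - A" for k
    define S where "S k = (\<Sum>i. \<alpha> (k + i) *\<^sub>R J (k + i))" for k
    have summ: "summable (\<lambda>i. \<alpha> (k + i) *\<^sub>R J (k + i))" for k
      using reg unfolding regular_seeds_def Let_def J_def S_def A_def by auto
    have S0: "S \<longlonglongrightarrow> 0" and SJ: "(\<lambda>k. S (Suc k) ** J k) \<longlonglongrightarrow> 0"
      using reg unfolding regular_seeds_def Let_def J_def S_def A_def by auto
    have S_Suc: "S k - S (Suc k) = \<alpha> k *\<^sub>R J k" for k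
      using suminf_split_head[OF summ[of k]] by (simp add: S_def)
    \<comment> \<open>Chosen so that \<open>c * norm (S k) * (1 + c * norm A)\<close> is at most
      \<epsilon> / 16; this bounds both products of \<open>S\<close> with \<open>A\<close> in the
      remainder.\<close>
    define \<epsilon>' where "\<epsilon>' = \<epsilon> / (16 * c * (1 + c * norm A))"
    have pos: "1 + c * norm A > 0" using c(1) by (simp add: add_pos_nonneg)
    then have \<epsilon>': "\<epsilon>' > 0" using c(1) \<open>\<epsilon> > 0\<close> by (simp add: \<epsilon>'_def)
    \<comment> \<open>The transformed difference starts along \<open>v - S K *v v\<close> instead of
      \<open>v\<close>; for late \<open>K\<close> the form is still positive there.\<close>
    have "(\<lambda>k. S k *v v) \<longlonglongrightarrow> 0 *v v"
      using bilinear_matrix_vector_mult S0 bilinear_conv_bounded_bilinear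
        bounded_bilinear.tendsto[OF _ S0 tendsto_const] by blast
    then have "(\<lambda>k. v - S k *v v) \<longlonglongrightarrow> v"
      by (auto intro!: tendsto_eq_intros)
    then have "(\<lambda>k. h (v - S k *v v) (v - S k *v v)) \<longlonglongrightarrow> h v v"
      using h(1) bilinear_conv_bounded_bilinear bounded_bilinear.tendsto by blast
    then have "\<forall>\<^sub>F k in sequentially. h (v - S k *v v) (v - S k *v v) > 0"
      using hv order_tendstoD(1) by blast
    moreover have "\<forall>\<^sub>F k in sequentially. norm (S k) < min (1 / (2 * c)) \<epsilon>'"
      using tendstoD[OF S0, of "min (1 / (2 * c)) \<epsilon>'"] c(1) \<epsilon>' by simp
    moreover have "\<forall>\<^sub>F k in sequentially. norm (S (Suc k) ** J k) < \<epsilon> / (16 * c)"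
      using tendstoD[OF SJ, of "\<epsilon> / (16 * c)"] c(1) \<open>\<epsilon> > 0\<close> by simp
    moreover have "\<forall>\<^sub>F k in sequentially. \<alpha> k < \<epsilon>"
      using order_tendstoD(2)[OF \<alpha>(2)] \<open>\<epsilon> > 0\<close> by blast
    ultimately have "\<forall>\<^sub>F k in sequentially. h (v - S k *v v) (v - S k *v v) > 0 \<and>
      norm (S k) < min (1 / (2 * c)) \<epsilon>' \<and> norm (S (Suc k) ** J k) < \<epsilon> / (16 * c) \<and> \<alpha> k < \<epsilon>"
      by eventually_elim auto
    then obtain K0 where K0: "\<And>k. k \<ge> K0 \<Longrightarrow> h (v - S k *v v) (v - S k *v v) > 0"
      "\<And>k. k \<ge> K0 \<Longrightarrow> norm (S k) < min (1 / (2 * c)) \<epsilon>'"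
      "\<And>k. k \<ge> K0 \<Longrightarrow> norm (S (Suc k) ** J k) < \<epsilon> / (16 * c)" "\<And>k. k \<ge> K0 \<Longrightarrow> \<alpha> k < \<epsilon>"
      unfolding eventually_sequentially by blast
    \<comment> \<open>This makes I - S_k boundedly invertible, so that |d| \<le> 2 |e| and errors
      relative to \<open>d\<close> become errors relative to \<open>e\<close>.\<close>
    have S_half: "norm (S k *v y) \<le> 1 / 2 * norm y" if "k \<ge> K0" for k y
    proof -
      have "c * norm (S k) \<le> 1 / 2" using K0(2)[OF that] c(1) by (simp add: field_simps)
      then show ?thesis using c(2)[of "S k" y] by (meson mult_right_mono norm_ge_zero order_trans)
    qed
    have S_A: "c * norm (S k) * (1 + c * norm A) \<le> \<epsilon> / 16" if "k \<ge> K0" for k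
    proof -
      have "norm (S k) \<le> \<epsilon>'" using K0(2)[OF that] by simp
      then have "norm (S k) * (c * (1 + c * norm A)) \<le> \<epsilon>' * (c * (1 + c * norm A))"
        using c(1) pos by (intro mult_right_mono) auto
      also have "\<dots> = \<epsilon>' * (16 * c * (1 + c * norm A)) / 16" by simp
      also have "\<epsilon>' * (16 * c * (1 + c * norm A)) = \<epsilon>" using c(1) pos by (simp add: \<epsilon>'_def)
      finally show ?thesis by (simp add: ac_simps)
    qed
    have "negligible {y. \<forall>n. orbit (\<lambda>n. oracle_step G (\<alpha> (K + n)) (x (K + n))) n y \<in> cball p r}"
      (is "negligible ?W") if K: "K \<ge> K0" for K
    proof (rule negligible_if_translates_disjoint)
      define T where "T n = oracle_step G (\<alpha> (K + n)) (x (K + n))" for n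
      have W: "?W = {y. \<forall>n. orbit T n y \<in> cball p r}" by (simp add: T_def[abs_def])
      have "?W \<subseteq> cball p r" unfolding W by (metis (mono_tags, lifting) mem_Collect_eq orbit.simps(1) subsetI)
      then show "bounded ?W" using bounded_cball bounded_subset by blast
      have "closed (orbit T n -` cball p r)" for n
        by (intro closed_vimage closed_cball continuous_on_orbit) (simp add: T_def cont)
      then have "closed (\<Inter>n. orbit T n -` cball p r)" by blast
      moreover have "?W = (\<Inter>n. orbit T n -` cball p r)" unfolding W by auto
      ultimately have "closed ?W" by simp
      then have "?W \<in> sets borel" by (rule borel_closed)
      then show "?W \<in> sets lebesgue" by simp
      show "t = 0" if y: "y \<in> ?W" "y + t *\<^sub>R v \<in> ?W" for y t
      proof (rule ccontr)
        assume "t \<noteq> 0"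
        define d where "d n = orbit T n (y + t *\<^sub>R v) - orbit T n y" for n
        define e where "e n = d n - S (K + n) *v d n" for n
        define R where "R n = G (orbit T n (y + t *\<^sub>R v)) (x (K + n)) - G (orbit T n y) (x (K + n))
          - D_oracle G p (x (K + n)) *v d n" for n
        \<comment> \<open>The remainder in \<open>noise_removal_identity\<close>, to be bounded
          relative to the transformed difference.\<close>
        define \<rho> where "\<rho> n = - (A *v (S (K + n) *v d n)) - R n + S (Suc (K + n)) *v (A *v d n)
          + (S (Suc (K + n)) ** J (K + n)) *v d n + S (Suc (K + n)) *v R n" for n
        have in_ball: "orbit T n (y + t *\<^sub>R v) \<in> cball p r" "orbit T n y \<in> cball p r" for n
          using y unfolding W by auto
        have R: "norm (R n) \<le> \<epsilon> / 8 * norm (d n)" for n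
          unfolding R_def d_def by (rule lin[OF seeds in_ball])
        have d_Suc: "d (Suc n) = d n - \<alpha> (K + n) *\<^sub>R ((A + J (K + n)) *v d n + R n)" for n
          by (simp add: d_def R_def J_def T_def oracle_step_def algebra_simps)
        have e_Suc: "e (Suc n) = e n + \<alpha> (K + n) *\<^sub>R ((- A) *v e n + \<rho> n)" for n
          using noise_removal_identity[OF S_Suc d_Suc, of n] by (simp add: e_def \<rho>_def)
        have d_le: "norm (d n) \<le> 2 * norm (e n)" for n
          using S_half[of "K + n" "d n"] K norm_triangle_sub[of "d n" "S (K + n) *v d n"]
          by (simp add: e_def)
        have \<rho>: "norm (\<rho> n) \<le> \<epsilon> * norm (e n)" for n
        proof -
          define D where "D = norm (d n)"
          have K': "K + n \<ge> K0" "Suc (K + n) \<ge> K0" using K by auto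
          have cS: "c * norm (S k) * (c * norm A) \<le> \<epsilon> / 16" if "k \<ge> K0" for k
            using S_A[OF that] c(1) by (smt (verit) mult_left_mono mult_nonneg_nonneg norm_ge_zero)
          have D: "D \<ge> 0" by (simp add: D_def)
          have "norm (A *v (S (K + n) *v d n)) \<le> c * norm A * (c * norm (S (K + n)) * D)"
            using c(2)[of A "S (K + n) *v d n"] c(2)[of "S (K + n)" "d n"] c(1) unfolding D_def
            by (meson mult_left_mono mult_nonneg_nonneg norm_ge_zero order_trans less_imp_le)
          also have "\<dots> \<le> \<epsilon> / 16 * D"
            using mult_right_mono[OF cS[OF K'(1)] D] by (simp add: ac_simps)
          finally have 1: "norm (A *v (S (K + n) *v d n)) \<le> \<epsilon> / 16 * D" .
          have "norm (S (Suc (K + n)) *v (A *v d n)) \<le> c * norm (S (Suc (K + n))) * (c * norm A * D)"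
            using c(2)[of "S (Suc (K + n))" "A *v d n"] c(2)[of A "d n"] c(1) unfolding D_def
            by (meson mult_left_mono mult_nonneg_nonneg norm_ge_zero order_trans less_imp_le)
          also have "\<dots> \<le> \<epsilon> / 16 * D"
            using mult_right_mono[OF cS[OF K'(2)] D] by (simp add: ac_simps)
          finally have 2: "norm (S (Suc (K + n)) *v (A *v d n)) \<le> \<epsilon> / 16 * D" .
          have "c * norm (S (Suc (K + n)) ** J (K + n)) \<le> \<epsilon> / 16"
            using K0(3)[OF K'(1)] c(1) by (simp add: field_simps)
          then have 3: "norm ((S (Suc (K + n)) ** J (K + n)) *v d n) \<le> \<epsilon> / 16 * D"
            using c(2)[of "S (Suc (K + n)) ** J (K + n)" "d n"] D unfolding D_def
            by (meson mult_right_mono order_trans)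
          have 4: "norm (S (Suc (K + n)) *v R n) \<le> 1 / 2 * norm (R n)" by (rule S_half[OF K'(2)])
          have "norm (\<rho> n) \<le> norm (A *v (S (K + n) *v d n)) + norm (R n)
            + norm (S (Suc (K + n)) *v (A *v d n)) + norm ((S (Suc (K + n)) ** J (K + n)) *v d n)
            + norm (S (Suc (K + n)) *v R n)"
            unfolding \<rho>_def by (smt (verit) norm_triangle_ineq norm_triangle_ineq4 norm_minus_cancel)
          \<comment> \<open>The budget adds up to 3/8 of \<epsilon> relative to \<open>d\<close>,
            hence 3/4 of \<epsilon> relative to \<open>e\<close>.\<close>
          also have "\<dots> \<le> \<epsilon> / 16 * D + \<epsilon> / 8 * D + \<epsilon> / 16 * D + \<epsilon> / 16 * D + 1 / 2 * (\<epsilon> / 8 * D)"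
            using 1 2 3 4 R[of n] unfolding D_def by linarith
          also have "\<dots> = 3 / 8 * \<epsilon> * D" by simp
          also have "\<dots> \<le> 3 / 8 * \<epsilon> * (2 * norm (e n))"
            using d_le[of n] \<open>\<epsilon> > 0\<close> unfolding D_def by (intro mult_left_mono) auto
          also have "\<dots> \<le> \<epsilon> * norm (e n)" using \<open>\<epsilon> > 0\<close> by simp
          finally show ?thesis .
        qed
        \<comment> \<open>The scalar \<open>t\<close> enters the form as a square, so either sign
          gives a positive start.\<close>
        have "e 0 = t *\<^sub>R (v - S K *v v)"
          by (simp add: e_def d_def matrix_vector_mult_scaleR algebra_simps)
        then have "h (e 0) (e 0) = t\<^sup>2 * h (v - S K *v v) (v - S K *v v)"
          by (simp only: bilinear_lmul[OF h(1)] bilinear_rmul[OF h(1)]) (simp add: power2_eq_square)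
        then have "h (e 0) (e 0) > 0" using K0(1)[OF K] \<open>t \<noteq> 0\<close> by simp
        then have "\<not> bounded (range e)"
          using escape[of "\<lambda>n. \<alpha> (K + n)" \<rho> e] \<rho> e_Suc \<alpha>(1) K0(4) K
            partial_sums_shift_at_top[OF \<alpha>(3)] by (simp add: less_imp_le)
        \<comment> \<open>Both orbits lie in a ball of radius \<open>r\<close>, so |d| \<le> 2 r,
          and I - S_k enlarges this by at most 3/2.\<close>
        moreover have "norm (e n) \<le> 3 * r" for n
        proof -
          have "norm (d n) \<le> 2 * r"
            using in_ball[of n] norm_triangle_ineq4[of "orbit T n (y + t *\<^sub>R v) - p" "orbit T n y - p"]
            by (simp add: d_def dist_norm norm_minus_commute)
          then show ?thesis
            using norm_triangle_ineq4[of "d n" "S (K + n) *v d n"] S_half[of "K + n" "d n"] K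
            by (simp add: e_def)
        qed
        ultimately show False unfolding bounded_iff by blast
      qed
    qed
    then show "\<exists>K0. \<forall>K\<ge>K0. negligible {y. \<forall>n.
        orbit (\<lambda>n. oracle_step G (\<alpha> (K + n)) (x (K + n))) n y \<in> cball p r}" by blast
  qed
qed

section \<open>Pulling null sets back through the steps\<close>

lemma locally_lipschitz_imp_continuous:
  assumes "locally_lipschitz f"
  shows "continuous_on UNIV f"
proof (rule continuous_at_imp_continuous_on, rule ballI)
  fix z
  obtain r L where "r > 0" "L-lipschitz_on (ball z r) f"
    using assms unfolding locally_lipschitz_def by blast
  then show "isCont f z"
    using lipschitz_on_continuous_on continuous_on_interior[of "ball z r" f z] by auto
qed

text \<open>For a bijection the preimage is the image under the inverse, and locally Lipschitz maps
  send null sets to null sets.\<close>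

lemma negligible_vimage_locally_lipschitz_inv:
  fixes f :: "real^'n \<Rightarrow> real^'n"
  assumes "bij f" "locally_lipschitz (inv f)" "negligible W"
  shows "negligible (f -` W)"
proof -
  have "negligible (inv f ` W)"
  proof (rule negligible_locally_Lipschitz_image[OF _ \<open>negligible W\<close>])
    fix x assume "x \<in> W"
    obtain r L where r: "r > 0" "L-lipschitz_on (ball x r) (inv f)"
      using assms(2) unfolding locally_lipschitz_def by blast
    then show "\<exists>T B. open T \<and> x \<in> T \<and> (\<forall>y\<in>W \<inter> T. norm (inv f y - inv f x) \<le> B * norm (y - x))"
      by (intro exI[of _ "ball x r"] exI[of _ L])
         (auto simp: dist_norm[symmetric] intro!: lipschitz_onD[OF r(2)])
  qed simp
  then show ?thesis using \<open>bij f\<close> by (simp add: bij_vimage_eq_inv_image)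
qed

lemma negligible_vimage_orbit:
  fixes T :: "nat \<Rightarrow> real^'n \<Rightarrow> real^'n"
  assumes "\<And>k. bij (T k)" "\<And>k. locally_lipschitz (inv (T k))" "negligible W"
  shows "negligible (orbit T n -` W)"
  using assms(3)
proof (induction n arbitrary: W)
  case (Suc n)
  have "orbit T (Suc n) -` W = orbit T n -` (T n -` W)" by auto
  then show ?case
    using Suc.IH[OF negligible_vimage_locally_lipschitz_inv[OF assms(1,2) Suc.prems]] by metis
qed (simp add: vimage_def)

lemma negligible_countable_Union_image:
  assumes "countable I" "\<And>i. i \<in> I \<Longrightarrow> negligible (f i)"
  shows "negligible (\<Union>i\<in>I. f i)"
  using assms by (intro negligible_countable_Union) auto

text \<open>An orbit converging into \<open>Z\<close> eventually stays in one of the covering balls,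
  so its starting point lies in a countable union, over balls and times, of pulled-back null
  sets.\<close>

lemma convergent_orbits_negligible:
  fixes T :: "nat \<Rightarrow> real^'n \<Rightarrow> real^'n"
  assumes T: "\<And>k. bij (T k)" "\<And>k. locally_lipschitz (inv (T k))"
    and P: "countable P" "Z \<subseteq> (\<Union>p\<in>P. ball p (r p))"
    and stay: "\<And>p. p \<in> P \<Longrightarrow> \<exists>K0. \<forall>K\<ge>K0. negligible {y. \<forall>n. orbit (\<lambda>n. T (K + n)) n y \<in> cball p (r p)}"
  shows "negligible {y. \<exists>l\<in>Z. (\<lambda>n. orbit T n y) \<longlonglongrightarrow> l}"
proof -
  define W where "W p K = {y. \<forall>n. orbit (\<lambda>n. T (K + n)) n y \<in> cball p (r p)}" for p K
  obtain K0 where K0: "\<And>p K. p \<in> P \<Longrightarrow> K \<ge> K0 p \<Longrightarrow> negligible (W p K)"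
    using stay unfolding W_def by metis
  have "negligible (\<Union>p\<in>P. \<Union>K\<in>{K0 p..}. orbit T K -` W p K)"
    by (intro negligible_countable_Union_image negligible_vimage_orbit P(1) T K0) auto
  moreover have "{y. \<exists>l\<in>Z. (\<lambda>n. orbit T n y) \<longlonglongrightarrow> l} \<subseteq> (\<Union>p\<in>P. \<Union>K\<in>{K0 p..}. orbit T K -` W p K)"
  proof safe
    fix y l assume "l \<in> Z" and lim: "(\<lambda>n. orbit T n y) \<longlonglongrightarrow> l"
    then obtain p where p: "p \<in> P" "l \<in> ball p (r p)" using P(2) by auto
    have "\<forall>\<^sub>F n in sequentially. orbit T n y \<in> ball p (r p)"
      using lim p(2) topological_tendstoD open_ball by blast
    then obtain K1 where K1: "\<And>n. n \<ge> K1 \<Longrightarrow> orbit T n y \<in> ball p (r p)"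
      unfolding eventually_sequentially by blast
    \<comment> \<open>Late enough both for the orbit to have entered the ball for good and for the
      staying set to be null.\<close>
    define K where "K = max K1 (K0 p)"
    have "orbit T (K + n) y \<in> cball p (r p)" for n
      using K1[of "K + n"] by (simp add: K_def less_imp_le)
    then have "orbit T K y \<in> W p K" unfolding W_def orbit_add by blast
    moreover have "K \<in> {K0 p..}" by (simp add: K_def)
    ultimately show "y \<in> (\<Union>p\<in>P. \<Union>K\<in>{K0 p..}. orbit T K -` W p K)" using p(1) by blast
  qed
  ultimately show ?thesis using negligible_subset by blast
qed

section \<open>Measurability of the convergence event\<close>

text \<open>Eigenpairs with |\<mu>| \<le> n, Re \<mu> \<le> -1/(n+1) and a unit eigenvector range
  over a compact set, and projecting a closed relation along a compact factor gives a closed set.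
  The union over n exhausts the open condition Re \<mu> < 0.\<close>

lemma sets_borel_matrices_with_unstable_eigenvalue:
  "{A::real^'n^'n. \<exists>\<mu>. complex_eigenvalue A \<mu> \<and> Re \<mu> < 0} \<in> sets borel"
proof -
  define S :: "nat \<Rightarrow> (complex \<times> (complex^'n)) set"
    where "S n = (cball 0 (real n) \<inter> {\<mu>. Re \<mu> \<le> - (1 / real (Suc n))}) \<times> sphere 0 1" for n
  define T :: "((complex \<times> (complex^'n)) \<times> (real^'n^'n)) set"
    where "T = {(x, A). map_matrix complex_of_real A *v snd x = fst x *s snd x}"
  have "compact (S n)" for n
    unfolding S_def by (intro compact_Times compact_Int_closed closed_halfspace_Re_le) auto
  moreover have "closed T"
    unfolding T_def case_prod_beta vec_eq_iff matrix_vector_mult_def map_matrix_def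
    by (simp, intro closed_Collect_all closed_Collect_eq continuous_intros)
  ultimately have closed: "closed {A. \<exists>x. x \<in> S n \<and> (x, A) \<in> T}" for n
    by (rule closed_compact_projection)
  have "{A. \<exists>\<mu>. complex_eigenvalue A \<mu> \<and> Re \<mu> < 0} = (\<Union>n. {A. \<exists>x. x \<in> S n \<and> (x, A) \<in> T})"
  proof safe
    fix A :: "real^'n^'n" and \<mu> assume "complex_eigenvalue A \<mu>" and \<mu>: "Re \<mu> < 0"
    then obtain v where v: "v \<noteq> 0" "map_matrix complex_of_real A *v v = \<mu> *s v"
      by (auto simp: complex_eigenvalue_def)
    define w where "w = complex_of_real (inverse (norm v)) *s v"
    have "norm w = 1" using v(1) by (simp add: w_def scaleR_complex_vector del: of_real_inverse)
    moreover have "map_matrix complex_of_real A *v w = \<mu> *s w"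
      using v(2) by (simp add: w_def vector_scalar_commute mult.commute)
    moreover obtain n1 where "inverse (real (Suc n1)) < - Re \<mu>"
      using reals_Archimedean[of "- Re \<mu>"] \<mu> by auto
    moreover obtain n2 where "norm \<mu> \<le> real n2" using real_arch_simple by blast
    moreover define n where "n = max n1 n2"
    moreover have "inverse (real (Suc n)) \<le> inverse (real (Suc n1))"
      by (rule le_imp_inverse_le) (auto simp: n_def)
    ultimately have "(\<mu>, w) \<in> S n" "((\<mu>, w), A) \<in> T"
      by (auto simp: S_def T_def inverse_eq_divide)
    then show "A \<in> (\<Union>n. {A. \<exists>x. x \<in> S n \<and> (x, A) \<in> T})" by blast
  next
    fix A :: "real^'n^'n" and n \<mu> v assume "(\<mu>, v) \<in> S n" "((\<mu>, v), A) \<in> T"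
    then have "Re \<mu> \<le> - (1 / real (Suc n))" "v \<noteq> 0"
      "map_matrix complex_of_real A *v v = \<mu> *s v" by (auto simp: S_def T_def)
    moreover have "1 / real (Suc n) > 0" by simp
    then have "Re \<mu> < 0" using calculation(1) by linarith
    ultimately show "\<exists>\<mu>. complex_eigenvalue A \<mu> \<and> Re \<mu> < 0"
      unfolding complex_eigenvalue_def by blast
  qed
  moreover have "(\<Union>n. {A. \<exists>x. x \<in> S n \<and> (x, A) \<in> T}) \<in> sets borel"
    using closed by (intro sets.countable_UN) auto
  ultimately show ?thesis by simp
qed

text \<open>Continuity of \<open>F\<close> and its Jacobian holds on \<open>V\<close> only, so
  measurability is first taken relative to \<open>V\<close>; since \<open>V\<close> is open,
  relatively measurable sets are Borel.\<close>

lemma sets_borel_unstable_zeros: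
  fixes F :: "real^'n \<Rightarrow> real^'n"
  assumes "C1_near F (unstable_zeros F)"
  shows "unstable_zeros F \<in> sets borel"
proof -
  obtain V where V: "open V" "unstable_zeros F \<subseteq> V" "\<And>z. z \<in> V \<Longrightarrow> F differentiable (at z)"
    "continuous_on V (\<lambda>z. jacobian F (at z))"
    using assms by (auto simp: C1_near_def)
  define E where "E = {A::real^'n^'n. \<exists>\<mu>. complex_eigenvalue A \<mu> \<and> Re \<mu> < 0}"
  have "continuous_on V F"
    using V(3) by (meson differentiable_imp_continuous_within continuous_at_imp_continuous_on)
  then have F: "F \<in> borel_measurable (restrict_space borel V)"
    by (rule borel_measurable_continuous_on_restrict)
  have J: "(\<lambda>z. jacobian F (at z)) \<in> borel_measurable (restrict_space borel V)"
    using V(4) by (rule borel_measurable_continuous_on_restrict)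
  have E: "E \<in> sets borel" unfolding E_def by (rule sets_borel_matrices_with_unstable_eigenvalue)
  have "F -` {0} \<inter> space (restrict_space borel V) \<in> sets (restrict_space borel V)"
    by (rule measurable_sets[OF F]) simp
  moreover have "(\<lambda>z. jacobian F (at z)) -` E \<inter> space (restrict_space borel V)
      \<in> sets (restrict_space borel V)"
    by (rule measurable_sets[OF J E])
  ultimately have "F -` {0} \<inter> V \<in> sets borel" "(\<lambda>z. jacobian F (at z)) -` E \<inter> V \<in> sets borel"
    using V(1) by (auto simp: sets_restrict_space_iff space_restrict_space)
  moreover have "unstable_zeros F = (F -` {0} \<inter> V) \<inter> ((\<lambda>z. jacobian F (at z)) -` E \<inter> V)"
    using V(2,3) by (auto simp: unstable_zeros_def E_def)
  ultimately show ?thesis by simp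
qed

lemma sets_Collect_tendsto_in:
  fixes z :: "nat \<Rightarrow> 'a \<Rightarrow> 'b::{banach, second_countable_topology}"
  assumes [measurable]: "\<And>k. z k \<in> borel_measurable M" and "Z \<in> sets borel"
  shows "{\<omega> \<in> space M. \<exists>l\<in>Z. (\<lambda>k. z k \<omega>) \<longlonglongrightarrow> l} \<in> sets M"
proof -
  have [measurable]: "Z \<in> sets borel" by fact
  \<comment> \<open>By completeness convergence is the Cauchy property; intersecting with it removes
    the points where \<open>lim\<close> has only a default value.\<close>
  have "{\<omega> \<in> space M. \<exists>l\<in>Z. (\<lambda>k. z k \<omega>) \<longlonglongrightarrow> l}
      = {\<omega> \<in> space M. Cauchy (\<lambda>k. z k \<omega>)} \<inter> ((\<lambda>\<omega>. lim (\<lambda>k. z k \<omega>)) -` Z \<inter> space M)"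
    by (auto simp: Cauchy_convergent_iff convergent_def limI)
  also have "\<dots> \<in> sets M" by measurable
  finally show ?thesis .
qed

section \<open>Avoidance of unstable zeros\<close>

theorem theorem2p14:
  fixes F :: "real^'n \<Rightarrow> real^'n"
    and \<Xi> :: "'x measure"
    and G :: "real^'n \<Rightarrow> 'x \<Rightarrow> real^'n"
    and U :: "real^'n \<Rightarrow> (real^'n) set"
    and P0 :: "'a measure" and z0 :: "'a \<Rightarrow> real^'n"
    and P\<xi> :: "'b measure" and \<xi> :: "nat \<Rightarrow> 'b \<Rightarrow> 'x"
    and \<alpha> :: "nat \<Rightarrow> real" and \<alpha>_max :: real
    and z :: "nat \<Rightarrow> 'a \<times> 'b \<Rightarrow> real^'n"
  assumes prob_P0: "prob_space P0"
    and z0_measurable: "z0 \<in> P0 \<rightarrow>\<^sub>M borel"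
    and z0_abs_cont: "absolutely_continuous lborel (distr P0 borel z0)"
    and prob_P\<xi>: "prob_space P\<xi>"
    and \<xi>_measurable: "\<And>k. \<xi> k \<in> P\<xi> \<rightarrow>\<^sub>M \<Xi>"
    and G_measurable: "(\<lambda>(y, x). G y x) \<in> borel \<Otimes>\<^sub>M \<Xi> \<rightarrow>\<^sub>M borel"
    and DG_measurable: "\<And>p. p \<in> unstable_zeros F \<Longrightarrow>
      (\<lambda>(y, x). D_oracle G y x) \<in> restrict_space borel (U p) \<Otimes>\<^sub>M \<Xi> \<rightarrow>\<^sub>M borel"
    and regularity: "C1_near F (unstable_zeros F)"
    and U_nbhd: "\<And>p. p \<in> unstable_zeros F \<Longrightarrow> open (U p) \<and> p \<in> U p"
    and equicontinuity: "\<And>p. p \<in> unstable_zeros F \<Longrightarrow>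
      locally_equicontinuous_derivative (space \<Xi>) G (U p)"
    and lipeomorphism: "lipeomorphic_oracle (space \<Xi>) G \<alpha>_max"
    and stochastic_oracle: "\<And>p. p \<in> unstable_zeros F \<Longrightarrow>
      \<exists>E \<in> sets P\<xi>. measure P\<xi> E = 1 \<and> (\<forall>\<omega>\<in>E. regular_seeds F G \<alpha> p (\<lambda>k. \<xi> k \<omega>))"
    and step_bounds: "\<And>k. 0 < \<alpha> k \<and> \<alpha> k \<le> \<alpha>_max"
    and step_vanish: "\<alpha> \<longlonglongrightarrow> 0"
    and step_diverge: "filterlim (\<lambda>n. \<Sum>k<n. \<alpha> k) at_top sequentially"
    and z_0: "\<And>\<omega>. \<omega> \<in> space (P0 \<Otimes>\<^sub>M P\<xi>) \<Longrightarrow> z 0 \<omega> = z0 (fst \<omega>)"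
    and z_Suc: "\<And>k \<omega>. \<omega> \<in> space (P0 \<Otimes>\<^sub>M P\<xi>) \<Longrightarrow>
      z (Suc k) \<omega> = z k \<omega> - \<alpha> k *\<^sub>R G (z k \<omega>) (\<xi> k (snd \<omega>))"
  shows "{\<omega> \<in> space (P0 \<Otimes>\<^sub>M P\<xi>). \<exists>l \<in> unstable_zeros F. (\<lambda>k. z k \<omega>) \<longlonglongrightarrow> l}
      \<in> null_sets (P0 \<Otimes>\<^sub>M P\<xi>)"
proof -
  interpret P0: prob_space P0 by (fact prob_P0)
  interpret P\<xi>: prob_space P\<xi> by (fact prob_P\<xi>)
  interpret pair_sigma_finite P0 P\<xi> ..
  define Z where "Z = unstable_zeros F"
  define Ev where "Ev = {\<omega> \<in> space (P0 \<Otimes>\<^sub>M P\<xi>). \<exists>l\<in>Z. (\<lambda>k. z k \<omega>) \<longlonglongrightarrow> l}"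
  have z_meas: "z k \<in> borel_measurable (P0 \<Otimes>\<^sub>M P\<xi>)" for k
  proof (induction k)
    case 0
    have "(\<lambda>\<omega>. z0 (fst \<omega>)) \<in> borel_measurable (P0 \<Otimes>\<^sub>M P\<xi>)"
      using z0_measurable by measurable
    then show ?case by (rule iffD2[OF measurable_cong, rotated]) (rule z_0)
  next
    case (Suc k)
    note [measurable] = Suc \<xi>_measurable
    have "(\<lambda>\<omega>. case (z k \<omega>, \<xi> k (snd \<omega>)) of (y, x) \<Rightarrow> G y x) \<in> borel_measurable (P0 \<Otimes>\<^sub>M P\<xi>)"
      by (rule measurable_compose[OF _ G_measurable]) measurable
    then have [measurable]: "(\<lambda>\<omega>. G (z k \<omega>) (\<xi> k (snd \<omega>))) \<in> borel_measurable (P0 \<Otimes>\<^sub>M P\<xi>)"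
      by simp
    have "(\<lambda>\<omega>. z k \<omega> - \<alpha> k *\<^sub>R G (z k \<omega>) (\<xi> k (snd \<omega>))) \<in> borel_measurable (P0 \<Otimes>\<^sub>M P\<xi>)"
      by measurable
    then show ?case by (rule iffD2[OF measurable_cong, rotated]) (rule z_Suc)
  qed
  have Ev_sets: "Ev \<in> sets (P0 \<Otimes>\<^sub>M P\<xi>)"
    unfolding Ev_def Z_def
    by (intro sets_Collect_tendsto_in z_meas sets_borel_unstable_zeros regularity)
  define stays where "stays p r x \<longleftrightarrow> (\<exists>K0. \<forall>K\<ge>K0. negligible {y. \<forall>n.
      orbit (\<lambda>n. oracle_step G (\<alpha> (K + n)) (x (K + n))) n y \<in> cball p r})" for p r x
  \<comment> \<open>The radius is quantified before the seed sequence, so that the cover of the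
    unstable zeros below is deterministic.\<close>
  have "\<forall>p\<in>Z. \<exists>r>0. \<forall>x. (\<forall>k. x k \<in> space \<Xi>) \<longrightarrow>
      (\<forall>k. continuous_on UNIV (oracle_step G (\<alpha> k) (x k))) \<longrightarrow> regular_seeds F G \<alpha> p x \<longrightarrow>
      stays p r x"
  proof
    fix p assume "p \<in> Z"
    then have p: "p \<in> unstable_zeros F" "open (U p)" "p \<in> U p" using U_nbhd by (auto simp: Z_def)
    show "\<exists>r>0. \<forall>x. (\<forall>k. x k \<in> space \<Xi>) \<longrightarrow>
        (\<forall>k. continuous_on UNIV (oracle_step G (\<alpha> k) (x k))) \<longrightarrow> regular_seeds F G \<alpha> p x \<longrightarrow>
        stays p r x"
      unfolding stays_def
      by (rule stay_set_negligible[OF p equicontinuity[OF p(1)], of \<alpha>])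
         (use step_bounds step_vanish step_diverge in \<open>auto\<close>)
  qed
  from bchoice[OF this] obtain r where r: "\<And>p. p \<in> Z \<Longrightarrow> r p > 0"
    and stay: "\<And>p x. p \<in> Z \<Longrightarrow> (\<And>k. x k \<in> space \<Xi>) \<Longrightarrow>
      (\<And>k. continuous_on UNIV (oracle_step G (\<alpha> k) (x k))) \<Longrightarrow> regular_seeds F G \<alpha> p x \<Longrightarrow>
      stays p (r p) x"
    by blast
  \<comment> \<open>The regularity event depends on the zero, and only countably many such events
    may be intersected; Lindelof reduces the cover to countably many centres.\<close>
  obtain B where B: "B \<subseteq> (\<lambda>p. ball p (r p)) ` Z" "countable B" "\<Union>B = (\<Union>p\<in>Z. ball p (r p))"
    using Lindelof[of "(\<lambda>p. ball p (r p)) ` Z"] by (metis (no_types, lifting) imageE open_ball)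
  obtain P where P: "countable P" "P \<subseteq> Z" "B = (\<lambda>p. ball p (r p)) ` P"
    using countable_subset_image[of B "\<lambda>p. ball p (r p)" Z] B(1,2) by auto
  have cover: "Z \<subseteq> (\<Union>p\<in>P. ball p (r p))"
    using B(3) r unfolding P(3) by force
  have "AE y in P\<xi>. \<forall>p\<in>P. regular_seeds F G \<alpha> p (\<lambda>k. \<xi> k y)"
  proof (subst AE_ball_countable[OF P(1)], rule ballI)
    fix p assume "p \<in> P"
    then obtain E where "E \<in> sets P\<xi>" "measure P\<xi> E = 1"
      "\<forall>\<omega>\<in>E. regular_seeds F G \<alpha> p (\<lambda>k. \<xi> k \<omega>)"
      using stochastic_oracle[of p] P(2) by (auto simp: Z_def)
    then show "AE y in P\<xi>. regular_seeds F G \<alpha> p (\<lambda>k. \<xi> k y)"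
      using P\<xi>.AE_prob_1[of E] by (auto elim: eventually_mono)
  qed
  \<comment> \<open>Fubini with the seeds fixed: for almost every seed realization the section of
    the event in the initial-point variable is shown to be null.\<close>
  then have "AE y in P\<xi>. emeasure P0 ((\<lambda>x. (x, y)) -` Ev) = 0"
    using AE_space
  proof eventually_elim
    case (elim y)
    define T where "T k = oracle_step G (\<alpha> k) (\<xi> k y)" for k
    have seed: "\<xi> k y \<in> space \<Xi>" for k using measurable_space[OF \<xi>_measurable] elim(2) by blast
    have T: "bij (T k)" "locally_lipschitz (T k)" "locally_lipschitz (inv (T k))" for k
      using lipeomorphism step_bounds[of k] seed[of k] unfolding lipeomorphic_oracle_def T_def by auto
    have "negligible {u. \<exists>l\<in>Z. (\<lambda>n. orbit T n u) \<longlonglongrightarrow> l}"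
    proof (rule convergent_orbits_negligible[OF T(1,3) P(1) cover])
      fix p assume "p \<in> P"
      then show "\<exists>K0. \<forall>K\<ge>K0. negligible {u. \<forall>n. orbit (\<lambda>n. T (K + n)) n u \<in> cball p (r p)}"
        using stay[of p "\<lambda>k. \<xi> k y"] seed elim(1) P(2) T(2) locally_lipschitz_imp_continuous
        unfolding T_def stays_def by blast
    qed
    \<comment> \<open>Absolute continuity compares measures on Borel sets, so the Lebesgue null set
      is first enclosed in a Borel null set.\<close>
    then obtain N where N: "N \<in> null_sets lborel" "{u. \<exists>l\<in>Z. (\<lambda>n. orbit T n u) \<longlonglongrightarrow> l} \<subseteq> N"
      unfolding negligible_iff_null_sets null_sets_completion_iff2 by blast
    have "N \<in> null_sets (distr P0 borel z0)"
      using N(1) z0_abs_cont by (auto simp: absolutely_continuous_def)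
    then have null: "z0 -` N \<inter> space P0 \<in> null_sets P0"
      using null_sets_distr_iff[OF z0_measurable] by simp
    have orbit: "z n (x, y) = orbit T n (z0 x)" if "x \<in> space P0" for n x
      using that elim(2) z_0[of "(x, y)"] z_Suc[of "(x, y)"]
      by (induction n) (auto simp: space_pair_measure T_def oracle_step_def)
    have "(\<lambda>x. (x, y)) -` Ev \<subseteq> z0 -` N \<inter> space P0"
    proof
      fix x assume "x \<in> (\<lambda>x. (x, y)) -` Ev"
      then have "x \<in> space P0" and "\<exists>l\<in>Z. (\<lambda>n. orbit T n (z0 x)) \<longlonglongrightarrow> l"
        by (auto simp: Ev_def space_pair_measure orbit)
      then show "x \<in> z0 -` N \<inter> space P0" using N(2) by blast
    qed
    then show ?case
      using null sets_Pair2[OF Ev_sets] null_sets_subset[OF null] by blast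
  qed
  then have "emeasure (P0 \<Otimes>\<^sub>M P\<xi>) Ev = 0"
    by (simp add: emeasure_pair_measure_alt2[OF Ev_sets] nn_integral_cong_AE[where v="\<lambda>_. 0"])
  then show ?thesis using Ev_sets by (auto simp: Ev_def Z_def null_sets_def)
qed

end
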